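(* a) $m_{\approx}(0)$ is an infinite-dimensional real vector space, if we take as vector addition and scalar multiplication the restrictions to $m_{\approx}(0)\times m_{\approx}(0)$ and $\mathbb{R}\times m_{\approx}(0)$, respectively, of the addition and the multiplication of $\widehat{\mathbb{R}}$. Moreover, $m_{\approx}(0)$ contains the real spaces $l^p$, for each $p\in[1,+\infty[$. b) If $m_{\approx}(0)$ is considered with the structure of real vector space mentioned in a), then $m_{\approx}(x)$ is an infinite-dimensional real affine space (with translations by $m_{\approx}(0)$), for each $x\in\widehat{\mathbb{R}}$.
   Context: $\widehat{\mathbb{R}}$ is the set of all convergent sequences of real numbers; a real number $\xi$ is identified with the constant sequence $(\xi)$, so $\mathbb{R}\subseteq\widehat{\mathbb{R}}$. $\sigma x\in\mathbb{R}$ is the limit of $x$. For $x=(\xi_n),y=(\eta_n)$: $x+y:=(\xi_n+\eta_n)$, $xy:=(\sigma x\,\eta_n+\sigma y\,\xi_n-\sigma x\,\sigma y)$ (so for $\xi\in\mathbb{R}$, $\xi x=(\xi\xi_n)$). $x\approx y$ means $\sigma x=\sigma y$, and $m_{\approx}(x):=\{y\in\widehat{\mathbb{R}}\mid y\approx x\}$; thus $m_{\approx}(x)=x+m_{\approx}(0)$. $l^p$ is the space of real sequences $(\xi_n)$ with $\sum_n|\xi_n|^p<+\infty$. *)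

theory Defs
  imports Complex_Main "HOL-Algebra.Module"
begin

section \<open>Vector spaces and affine spaces with explicit carriers\<close>

locale vectorspace = module K V + field K for K (structure) and V (structure)

definition finite_dimensional :: "('k, 'm) ring_scheme \<Rightarrow> ('k, 'v, 'n) module_scheme \<Rightarrow> bool" where
  "finite_dimensional K V \<longleftrightarrow>
     (\<exists>B. finite B \<and> B \<subseteq> carrier V \<and>
        (\<forall>v\<in>carrier V. \<exists>c\<in>B \<rightarrow> carrier K. v = (\<Oplus>\<^bsub>V\<^esub>b\<in>B. c b \<odot>\<^bsub>V\<^esub> b)))"

text \<open>\<open>W\<close> is a vector space in its own right, and its operations are those of \<open>V\<close>.\<close>

definition vector_subspace ::
  "('k, 'm) ring_scheme \<Rightarrow> ('k, 'v, 'n) module_scheme \<Rightarrow> ('k, 'v, 'n) module_scheme \<Rightarrow> bool" where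
  "vector_subspace K W V \<longleftrightarrow>
     vectorspace K W \<and> vectorspace K V \<and> carrier W \<subseteq> carrier V \<and>
     (\<forall>x\<in>carrier W. \<forall>y\<in>carrier W. x \<oplus>\<^bsub>W\<^esub> y = x \<oplus>\<^bsub>V\<^esub> y) \<and>
     (\<forall>a\<in>carrier K. \<forall>x\<in>carrier W. a \<odot>\<^bsub>W\<^esub> x = a \<odot>\<^bsub>V\<^esub> x)"

text \<open>
  An affine space over \<open>V\<close>: a nonempty set \<open>A\<close> of points on which the additive group of \<open>V\<close>
  acts freely and transitively; \<open>tr a v\<close> is the translate of the point \<open>a\<close> by the vector \<open>v\<close>.
\<close>

locale affine_space = vectorspace K V for K (structure) and V (structure) +
  fixes A :: "'p set" and tr :: "'p \<Rightarrow> 'c \<Rightarrow> 'p"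
  assumes nonempty: "A \<noteq> {}"
    and translate_closed: "\<lbrakk>a \<in> A; v \<in> carrier V\<rbrakk> \<Longrightarrow> tr a v \<in> A"
    and translate_zero: "a \<in> A \<Longrightarrow> tr a \<zero>\<^bsub>V\<^esub> = a"
    and translate_add:
      "\<lbrakk>a \<in> A; v \<in> carrier V; w \<in> carrier V\<rbrakk> \<Longrightarrow> tr a (v \<oplus>\<^bsub>V\<^esub> w) = tr (tr a v) w"
    and translate_unique: "\<lbrakk>a \<in> A; b \<in> A\<rbrakk> \<Longrightarrow> \<exists>!v. v \<in> carrier V \<and> tr a v = b"

definition infinite_dimensional_vectorspace ::
  "('k, 'm) ring_scheme \<Rightarrow> ('k, 'v, 'n) module_scheme \<Rightarrow> bool" where
  "infinite_dimensional_vectorspace K V \<longleftrightarrow> vectorspace K V \<and> \<not> finite_dimensional K V"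

text \<open>The dimension of an affine space is that of its space of translations.\<close>

definition infinite_dimensional_affine_space ::
  "('k, 'm) ring_scheme \<Rightarrow> ('k, 'v, 'n) module_scheme \<Rightarrow> 'p set \<Rightarrow> ('p \<Rightarrow> 'v \<Rightarrow> 'p) \<Rightarrow> bool" where
  "infinite_dimensional_affine_space K V A tr \<longleftrightarrow>
     affine_space K V A tr \<and> \<not> finite_dimensional K V"

definition real_field :: "real ring" where
  "real_field = \<lparr>carrier = UNIV, monoid.mult = (*), one = 1, zero = 0, add = (+)\<rparr>"

section \<open>Convergent real sequences\<close>

definition rhat :: "(nat \<Rightarrow> real) set" where
  "rhat = {x. convergent x}"

definition const_seq :: "real \<Rightarrow> nat \<Rightarrow> real" where
  "const_seq \<xi> = (\<lambda>n. \<xi>)"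

definition \<sigma> :: "(nat \<Rightarrow> real) \<Rightarrow> real" where
  "\<sigma> x = lim x"

definition hat_add :: "(nat \<Rightarrow> real) \<Rightarrow> (nat \<Rightarrow> real) \<Rightarrow> nat \<Rightarrow> real" where
  "hat_add x y = (\<lambda>n. x n + y n)"

definition hat_mult :: "(nat \<Rightarrow> real) \<Rightarrow> (nat \<Rightarrow> real) \<Rightarrow> nat \<Rightarrow> real" where
  "hat_mult x y = (\<lambda>n. \<sigma> x * y n + \<sigma> y * x n - \<sigma> x * \<sigma> y)"

definition hat_approx :: "(nat \<Rightarrow> real) \<Rightarrow> (nat \<Rightarrow> real) \<Rightarrow> bool" where
  "hat_approx x y \<longleftrightarrow> \<sigma> x = \<sigma> y"

definition m_approx :: "(nat \<Rightarrow> real) \<Rightarrow> (nat \<Rightarrow> real) set" where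
  "m_approx x = {y \<in> rhat. hat_approx y x}"

text \<open>
  Scalar multiplication is multiplication of convergent sequences, a real number being
  identified with a constant sequence. The fields \<open>mult\<close> and \<open>one\<close>, which module records
  inherit from ring records, play no role in the notion of a module and are left undefined.
\<close>

definition m_approx_0_space :: "(real, nat \<Rightarrow> real) module" where
  "m_approx_0_space =
     \<lparr>carrier = m_approx (const_seq 0), monoid.mult = undefined, one = undefined,
      zero = const_seq 0, add = hat_add, smult = (\<lambda>\<xi> x. hat_mult (const_seq \<xi>) x)\<rparr>"

text \<open>The real space \<open>l\<^sup>p\<close>, with its usual termwise operations.\<close>

definition lp_space :: "real \<Rightarrow> (real, nat \<Rightarrow> real) module" where
  "lp_space p =
     \<lparr>carrier = {x. summable (\<lambda>n. \<bar>x n\<bar> powr p)}, monoid.mult = undefined, one = undefined,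
      zero = (\<lambda>n. 0), add = (\<lambda>x y n. x n + y n), smult = (\<lambda>\<xi> x n. \<xi> * x n)\<rparr>"

end

theory Submission
  imports Defs
begin

text \<open>
  The monad of \<open>0\<close> is the space of null sequences. It has no finite spanning set \<open>B\<close>: with
  \<open>M n = (\<Sum>b\<in>B. \<bar>b n\<bar>)\<close>, every linear combination of \<open>B\<close> is \<open>O(M)\<close>, whereas the null sequence
  \<open>sqrt (M n) + 1 / (n + 1)\<close> is not.
\<close>

lemma field_real_field: "field real_field"
proof (rule cring.cring_fieldI2)
  show "cring real_field"
  proof (rule cringI)
    show "abelian_group real_field"
      by (rule abelian_groupI)
        (auto simp: real_field_def intro: exI[of _ "- x" for x :: real])
    show "comm_monoid real_field"
      by (rule comm_monoidI) (auto simp: real_field_def)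
  qed (auto simp: real_field_def algebra_simps)
next
  fix a assume "a \<in> carrier real_field" "a \<noteq> \<zero>\<^bsub>real_field\<^esub>"
  then show "\<exists>b\<in>carrier real_field. a \<otimes>\<^bsub>real_field\<^esub> b = \<one>\<^bsub>real_field\<^esub>"
    by (intro bexI[of _ "inverse a"]) (auto simp: real_field_def)
qed (simp add: real_field_def)

text \<open>The vector space laws hold termwise in the reals, so only closure has to be checked.
  This serves both \<open>m_approx_0_space\<close> and \<open>lp_space\<close>.\<close>

lemma vectorspace_real_sequencesI:
  fixes V :: "(real, nat \<Rightarrow> real) module"
  assumes zero: "\<zero>\<^bsub>V\<^esub> = (\<lambda>n. 0)"
    and add: "\<And>x y. x \<oplus>\<^bsub>V\<^esub> y = (\<lambda>n. x n + y n)"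
    and smult: "\<And>a x. x \<in> carrier V \<Longrightarrow> a \<odot>\<^bsub>V\<^esub> x = (\<lambda>n. a * x n)"
    and zero_mem: "(\<lambda>n. 0) \<in> carrier V"
    and add_mem: "\<And>x y. x \<in> carrier V \<Longrightarrow> y \<in> carrier V \<Longrightarrow> (\<lambda>n. x n + y n) \<in> carrier V"
    and smult_mem: "\<And>a x. x \<in> carrier V \<Longrightarrow> (\<lambda>n. a * x n) \<in> carrier V"
  shows "vectorspace real_field V"
proof -
  interpret field real_field by (rule field_real_field)
  have "abelian_group V"
  proof (rule abelian_groupI)
    fix x assume "x \<in> carrier V"
    \<comment> \<open>Additive inverses come from closure under the scalar -1.\<close>
    then have "(\<lambda>n. - x n) \<in> carrier V" using smult_mem[of x "-1"] by simp
    then show "\<exists>y\<in>carrier V. y \<oplus>\<^bsub>V\<^esub> x = \<zero>\<^bsub>V\<^esub>"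
      by (auto simp: add zero intro!: bexI[of _ "\<lambda>n. - x n"])
  qed (auto simp: add zero zero_mem add_mem add.commute add.left_commute add.assoc)
  then have "module real_field V"
    by (rule moduleI[OF is_cring])
      (auto simp: add smult add_mem smult_mem real_field_def algebra_simps)
  then show ?thesis
    by (simp add: vectorspace_def field_real_field)
qed

lemma tendsto_\<sigma>: "x \<in> rhat \<Longrightarrow> x \<longlonglongrightarrow> \<sigma> x"
  by (simp add: rhat_def \<sigma>_def convergent_LIMSEQ_iff)

lemma \<sigma>_eqI: "x \<longlonglongrightarrow> a \<Longrightarrow> \<sigma> x = a"
  by (simp add: \<sigma>_def limI)

lemma \<sigma>_const_seq [simp]: "\<sigma> (const_seq a) = a"
  by (rule \<sigma>_eqI) (simp add: const_seq_def)

lemma m_approx_iff: "y \<in> m_approx x \<longleftrightarrow> y \<longlonglongrightarrow> \<sigma> x"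
proof
  assume "y \<in> m_approx x"
  then show "y \<longlonglongrightarrow> \<sigma> x"
    using tendsto_\<sigma>[of y] by (simp add: m_approx_def hat_approx_def)
next
  assume "y \<longlonglongrightarrow> \<sigma> x"
  then show "y \<in> m_approx x"
    by (auto simp: m_approx_def hat_approx_def rhat_def convergent_def dest: \<sigma>_eqI)
qed

lemma carrier_m_approx_0_space: "carrier m_approx_0_space = {x. x \<longlonglongrightarrow> 0}"
  by (auto simp: m_approx_0_space_def m_approx_iff)

lemma add_m_approx_0_space: "x \<oplus>\<^bsub>m_approx_0_space\<^esub> y = (\<lambda>n. x n + y n)"
  by (simp add: m_approx_0_space_def hat_add_def)

lemma zero_m_approx_0_space: "\<zero>\<^bsub>m_approx_0_space\<^esub> = (\<lambda>n. 0)"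
  by (simp add: m_approx_0_space_def const_seq_def)

text \<open>Apart from \<open>a * x n\<close>, every term of \<open>hat_mult (const_seq a) x\<close>
  carries the factor \<open>\<sigma> x\<close>, which is 0 for a null sequence.\<close>

lemma smult_m_approx_0_space:
  "x \<longlonglongrightarrow> 0 \<Longrightarrow> a \<odot>\<^bsub>m_approx_0_space\<^esub> x = (\<lambda>n. a * x n)"
  using \<sigma>_eqI[of x 0] by (simp add: m_approx_0_space_def hat_mult_def const_seq_def \<sigma>_eqI[OF tendsto_const])

lemmas m_approx_0_space_simps =
  carrier_m_approx_0_space add_m_approx_0_space zero_m_approx_0_space smult_m_approx_0_space

lemma vectorspace_m_approx_0_space: "vectorspace real_field m_approx_0_space"
  by (rule vectorspace_real_sequencesI)
    (auto simp: m_approx_0_space_simps intro: tendsto_add_zero tendsto_mult_right_zero)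

text \<open>Turns the module sums in the definition of span into ordinary real sums at each index,
  where they can be estimated. The null limits keep the summands in the carrier.\<close>

lemma finsum_m_approx_0_space:
  assumes "finite B" "\<And>b. b \<in> B \<Longrightarrow> f b \<longlonglongrightarrow> 0"
  shows "finsum m_approx_0_space f B = (\<lambda>n. \<Sum>b\<in>B. f b n)"
proof -
  interpret vectorspace real_field m_approx_0_space by (rule vectorspace_m_approx_0_space)
  show ?thesis using assms
  proof (induction B)
    case empty
    then show ?case by (simp add: m_approx_0_space_simps)
  next
    case (insert b B)
    then have "f \<in> B \<rightarrow> carrier m_approx_0_space" "f b \<in> carrier m_approx_0_space"
      by (auto simp: m_approx_0_space_simps)
    with insert show ?case by (simp add: add_m_approx_0_space)
  qed
qed

lemma not_finite_dimensional_m_approx_0_space: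
  "\<not> finite_dimensional real_field m_approx_0_space"
proof
  assume "finite_dimensional real_field m_approx_0_space"
  then obtain B where fin: "finite B" and B: "\<And>b. b \<in> B \<Longrightarrow> b \<longlonglongrightarrow> 0"
    and span: "\<And>v. v \<longlonglongrightarrow> 0 \<Longrightarrow>
      \<exists>c\<in>B \<rightarrow> carrier real_field.
        v = finsum m_approx_0_space (\<lambda>b. c b \<odot>\<^bsub>m_approx_0_space\<^esub> b) B"
    unfolding finite_dimensional_def carrier_m_approx_0_space by blast
  define M where "M n = (\<Sum>b\<in>B. \<bar>b n\<bar>)" for n
  \<comment> \<open>For small \<open>M n\<close> the root is much larger than \<open>M n\<close>
    itself. The term \<open>1 / real (Suc n)\<close> makes \<open>v n\<close> strictly larger than
    the root, also where \<open>M n\<close> vanishes.\<close>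
  define v where "v n = sqrt (M n) + 1 / real (Suc n)" for n
  have M_nonneg: "0 \<le> M n" for n by (simp add: M_def sum_nonneg)
  have "M \<longlonglongrightarrow> 0"
    unfolding M_def by (rule tendsto_null_sum) (rule tendsto_rabs_zero[OF B])
  then have sqrt_M: "(\<lambda>n. sqrt (M n)) \<longlonglongrightarrow> 0"
    using tendsto_real_sqrt[of M 0] by simp
  have "v \<longlonglongrightarrow> 0"
    unfolding v_def by (rule tendsto_add_zero[OF sqrt_M lim_1_over_n[THEN LIMSEQ_Suc]])
  from span[OF this] obtain c
    where "v = finsum m_approx_0_space (\<lambda>b. c b \<odot>\<^bsub>m_approx_0_space\<^esub> b) B" by blast
  also have "\<dots> = (\<lambda>n. \<Sum>b\<in>B. (c b \<odot>\<^bsub>m_approx_0_space\<^esub> b) n)"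
    using fin B
    by (intro finsum_m_approx_0_space)
      (auto simp: smult_m_approx_0_space intro: tendsto_mult_right_zero)
  finally have v_eq: "v n = (\<Sum>b\<in>B. c b * b n)" for n
    using B by (simp add: smult_m_approx_0_space cong: sum.cong)
  define C where "C = (\<Sum>b\<in>B. \<bar>c b\<bar>)"
  \<comment> \<open>Triangle inequality, then each \<open>\<bar>b n\<bar>\<close> is bounded by the
    sum \<open>M n\<close> in which it is a summand.\<close>
  have v_le: "v n \<le> C * M n" for n
  proof -
    have "v n \<le> (\<Sum>b\<in>B. \<bar>c b\<bar> * \<bar>b n\<bar>)"
      unfolding v_eq by (intro sum_mono) (metis abs_ge_self abs_mult)
    also have "\<dots> \<le> (\<Sum>b\<in>B. \<bar>c b\<bar> * M n)"
      unfolding M_def using fin by (intro sum_mono mult_left_mono member_le_sum) auto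
    finally show ?thesis by (simp add: C_def sum_distrib_right)
  qed
  have "1 \<le> C * sqrt (M n)" for n
  proof -
    have less: "sqrt (M n) < C * M n"
      by (rule less_le_trans[OF _ v_le]) (simp add: v_def)
    \<comment> \<open>If \<open>M n\<close> were 0, \<open>less\<close> would read 0 < 0. Hence it
      may be divided by the root, using that \<open>M n\<close> is the square of
      \<open>sqrt (M n)\<close>.\<close>
    then have pos: "0 < sqrt (M n)"
      using M_nonneg[of n] by (cases "M n = 0") auto
    have "1 * sqrt (M n) < (C * sqrt (M n)) * sqrt (M n)"
      using less M_nonneg[of n] by (simp add: mult.assoc)
    then show ?thesis
      using pos mult_less_cancel_right_pos[OF pos] by fastforce
  qed
  \<comment> \<open>A sequence bounded below by 1 cannot tend to 0.\<close>
  moreover have "(\<lambda>n. C * sqrt (M n)) \<longlonglongrightarrow> 0"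
    by (rule tendsto_mult_right_zero[OF sqrt_M])
  ultimately show False
    using LIMSEQ_le_const[of _ 0 1] by fastforce
qed

text \<open>The sum is at most twice the larger absolute value, whose power is one of the two
  summands on the right. This crude constant suffices for summability, so Minkowski's inequality is
  avoided.\<close>

lemma abs_add_powr_le:
  fixes a b p :: real
  assumes "0 \<le> p"
  shows "\<bar>a + b\<bar> powr p \<le> 2 powr p * (\<bar>a\<bar> powr p + \<bar>b\<bar> powr p)"
proof -
  have "\<bar>a + b\<bar> powr p \<le> (2 * max \<bar>a\<bar> \<bar>b\<bar>) powr p"
    using assms by (intro powr_mono2) auto
  also have "\<dots> = 2 powr p * max \<bar>a\<bar> \<bar>b\<bar> powr p"
    by (simp add: powr_mult)
  also have "\<dots> \<le> 2 powr p * (\<bar>a\<bar> powr p + \<bar>b\<bar> powr p)"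
    by (intro mult_left_mono) (auto simp: max_def)
  finally show ?thesis .
qed

lemma vectorspace_lp_space:
  assumes "0 < p"
  shows "vectorspace real_field (lp_space p)"
proof (rule vectorspace_real_sequencesI)
  fix x y assume "x \<in> carrier (lp_space p)" "y \<in> carrier (lp_space p)"
  then have summable: "summable (\<lambda>n. 2 powr p * (\<bar>x n\<bar> powr p + \<bar>y n\<bar> powr p))"
    by (auto simp: lp_space_def intro!: summable_mult summable_add)
  have "summable (\<lambda>n. \<bar>x n + y n\<bar> powr p)"
    by (rule summable_comparison_test'[OF summable]) (use assms abs_add_powr_le in simp)
  then show "(\<lambda>n. x n + y n) \<in> carrier (lp_space p)"
    by (simp add: lp_space_def)
next
  fix a x assume "x \<in> carrier (lp_space p)"
  then show "(\<lambda>n. a * x n) \<in> carrier (lp_space p)"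
    by (auto simp: lp_space_def abs_mult powr_mult intro: summable_mult)
qed (use assms in \<open>auto simp: lp_space_def\<close>)

lemma lp_space_tendsto_0:
  assumes "0 < p" "x \<in> carrier (lp_space p)"
  shows "x \<longlonglongrightarrow> 0"
proof -
  have "(\<lambda>n. \<bar>x n\<bar> powr p) \<longlonglongrightarrow> 0"
    using assms(2) by (simp add: lp_space_def summable_LIMSEQ_zero)
  \<comment> \<open>Taking p-th roots preserves the limit even though the base tends to 0, because
    the exponent \<open>1 / p\<close> is positive and the bases are nonnegative.\<close>
  then have "(\<lambda>n. (\<bar>x n\<bar> powr p) powr (1 / p)) \<longlonglongrightarrow> 0 powr (1 / p)"
    using assms(1) by (intro tendsto_powr') auto
  then show ?thesis
    using assms(1) by (simp add: powr_powr tendsto_rabs_zero_iff)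
qed

text \<open>Elements of \<open>lp_space p\<close> are null sequences, and on these the scalar
  multiplication derived from \<open>hat_mult\<close> is the termwise one.\<close>

lemma vector_subspace_lp_space:
  assumes "0 < p"
  shows "vector_subspace real_field (lp_space p) m_approx_0_space"
  using vectorspace_lp_space[OF assms] vectorspace_m_approx_0_space lp_space_tendsto_0[OF assms]
  by (auto simp: vector_subspace_def m_approx_0_space_simps) (auto simp: lp_space_def)

lemma affine_space_m_approx:
  assumes "x \<in> rhat"
  shows "affine_space real_field m_approx_0_space (m_approx x) hat_add"
proof (intro affine_space.intro affine_space_axioms.intro)
  show "m_approx x \<noteq> {}"
    \<comment> \<open>The point is \<open>x\<close> itself; this is where its convergence
      enters.\<close>
    using tendsto_\<sigma>[OF assms] m_approx_iff by blast
next
  fix a v assume "a \<in> m_approx x" "v \<in> carrier m_approx_0_space"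
  then show "hat_add a v \<in> m_approx x"
    using tendsto_add[of a "\<sigma> x" sequentially v 0]
    by (simp add: m_approx_0_space_simps m_approx_iff hat_add_def)
next
  fix a b assume "a \<in> m_approx x" "b \<in> m_approx x"
  \<comment> \<open>Solving \<open>hat_add a v = b\<close> termwise forces
    \<open>v n = b n - a n\<close>, which gives uniqueness. Existence needs this difference to be
    null, and it is, since \<open>a\<close> and \<open>b\<close> share the limit
    \<open>\<sigma> x\<close>.\<close>
  then have "(\<lambda>n. b n - a n) \<longlonglongrightarrow> 0"
    using tendsto_diff[of b "\<sigma> x" sequentially a "\<sigma> x"] by (simp add: m_approx_iff)
  then show "\<exists>!v. v \<in> carrier m_approx_0_space \<and> hat_add a v = b"
    by (intro ex1I[of _ "\<lambda>n. b n - a n"]) (auto simp: m_approx_0_space_simps hat_add_def)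
qed (auto simp: vectorspace_m_approx_0_space m_approx_0_space_simps hat_add_def add.assoc)

theorem proposition4p2:
  shows "(infinite_dimensional_vectorspace real_field m_approx_0_space \<and>
          (\<forall>p::real. 1 \<le> p \<longrightarrow> vector_subspace real_field (lp_space p) m_approx_0_space)) \<and>
         (\<forall>x\<in>rhat. infinite_dimensional_affine_space real_field m_approx_0_space
                      (m_approx x) hat_add)"
  using vectorspace_m_approx_0_space not_finite_dimensional_m_approx_0_space
    vector_subspace_lp_space affine_space_m_approx
  by (simp add: infinite_dimensional_vectorspace_def infinite_dimensional_affine_space_def)

end
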